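(* Let $n\ge 4$ be even and let $\mathbb{D}=(\{1,\ldots,n\},\mathcal{B})$ be an $\frac{n-2}{2}$-$(n,\frac n2,1)$ design. Let $w\in \mathrm{GF}(2)^n$ with $\mathrm{wt}(w)=n/2$, and let $B$ be the support of $w$. Then $$\hat f_{\mathbb{D}}(w)=\sum_{i=0}^{n/2}(-1)^iy_i,$$ where $y_0,y_1,\ldots,y_{n/2}$ are uniquely determined by the following system of equations: $$\sum_{i=r}^{n/2}\binom{i}{r}y_i=\binom{n/2}{r}\lambda_r\quad\text{for all } 0\le r\le \tfrac{n-2}{2},$$ $$y_0=y_{n/2}=\begin{cases}1&\text{if } B\in\mathcal{B},\\ 0&\text{if } B\notin\mathcal{B}.\end{cases}$$
   Context: A $t$-$(n,k,\lambda)$ design, $1\le t\le k\le n$, is a pair $(\mathcal{P},\mathcal{B})$ where $\mathcal{P}=\{1,\ldots,n\}$ and $\mathcal{B}$ is a set of $k$-subsets (blocks) of $\mathcal{P}$ such that every $t$-subset of $\mathcal{P}$ is contained in exactly $\lambda$ blocks. For $0\le s\le t$, $\lambda_s=\lambda\binom{n-s}{t-s}/\binom{k-s}{t-s}$, which is the number of blocks containing any given $s$-subset of points; here $t=\frac{n-2}{2}$, $k=\frac n2$, $\lambda=1$. The support of $x\in \mathrm{GF}(2)^n$ is $\{i: x_i=1\}$, and $\mathrm{wt}(x)$ is its cardinality. The characteristic function $f_{\mathbb{D}}:\mathrm{GF}(2)^n\to\{0,1\}\subset\mathbb{R}$ has $f_{\mathbb{D}}(x)=1$ if and only if the support of $x$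 is a block. The Walsh transform is $\hat f(w)=\sum_{x\in \mathrm{GF}(2)^n}f(x)(-1)^{w\cdot x}$, where $w\cdot x=\sum_i w_ix_i$. *)

theory Defs
  imports Complex_Main "HOL-Library.FuncSet" "HOL-Library.Z2"
begin

text \<open>
  Vectors over GF(2) (type \<open>bit\<close>) are extensional functions, i.e. \<open>undefined\<close> outside
  \<open>{1..n}\<close>, so that \<open>gf2_vec n\<close> has exactly \<open>2 ^ n\<close> elements.
\<close>

definition gf2_vec :: "nat \<Rightarrow> (nat \<Rightarrow> bit) set" where
  "gf2_vec n = {1..n} \<rightarrow>\<^sub>E UNIV"

definition gf2_dot :: "nat \<Rightarrow> (nat \<Rightarrow> bit) \<Rightarrow> (nat \<Rightarrow> bit) \<Rightarrow> bit" where
  "gf2_dot n w x = (\<Sum>i\<in>{1..n}. w i * x i)"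

definition supp :: "nat \<Rightarrow> (nat \<Rightarrow> bit) \<Rightarrow> nat set" where
  "supp n x = {i \<in> {1..n}. x i = 1}"

definition wt :: "nat \<Rightarrow> (nat \<Rightarrow> bit) \<Rightarrow> nat" where
  "wt n x = card (supp n x)"

definition walsh :: "nat \<Rightarrow> ((nat \<Rightarrow> bit) \<Rightarrow> real) \<Rightarrow> (nat \<Rightarrow> bit) \<Rightarrow> real" where
  "walsh n f w = (\<Sum>x\<in>gf2_vec n. f x * (- 1) ^ of_bit (gf2_dot n w x))"

definition t_design :: "nat \<Rightarrow> nat \<Rightarrow> nat \<Rightarrow> nat \<Rightarrow> nat set set \<Rightarrow> bool" where
  "t_design t n k l \<B> \<longleftrightarrow>
     1 \<le> t \<and> t \<le> k \<and> k \<le> n \<and>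
     (\<forall>A\<in>\<B>. A \<subseteq> {1..n} \<and> card A = k) \<and>
     (\<forall>T. T \<subseteq> {1..n} \<and> card T = t \<longrightarrow> card {A \<in> \<B>. T \<subseteq> A} = l)"

definition design_lambda :: "nat \<Rightarrow> nat \<Rightarrow> nat \<Rightarrow> nat \<Rightarrow> nat \<Rightarrow> real" where
  "design_lambda t n k l s =
     real l * real ((n - s) choose (t - s)) / real ((k - s) choose (t - s))"

definition char_fun :: "nat \<Rightarrow> nat set set \<Rightarrow> (nat \<Rightarrow> bit) \<Rightarrow> real" where
  "char_fun n \<B> x = (if supp n x \<in> \<B> then 1 else 0)"

text \<open>
  Only the values of \<open>y\<close> on \<open>{0..n div 2}\<close> matter. The right-hand sides use the parameters
  \<open>t = (n - 2) / 2\<close>, \<open>k = n / 2\<close>, \<open>\<lambda> = 1\<close>; both divisions are exact for even \<open>n\<close>.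
\<close>

definition y_system :: "nat \<Rightarrow> nat set set \<Rightarrow> nat set \<Rightarrow> (nat \<Rightarrow> real) \<Rightarrow> bool" where
  "y_system n \<B> B y \<longleftrightarrow>
     (\<forall>r\<in>{0..(n - 2) div 2}.
        (\<Sum>i=r..n div 2. real (i choose r) * y i)
          = real ((n div 2) choose r) * design_lambda ((n - 2) div 2) n (n div 2) 1 r) \<and>
     y 0 = (if B \<in> \<B> then 1 else 0) \<and>
     y (n div 2) = (if B \<in> \<B> then 1 else 0)"

end

theory Submission
  imports Defs
begin

text \<open>
  Put \<open>m = n div 2\<close>, so that the blocks and \<open>B\<close> all have \<open>m\<close> points and the strength of the
  design is \<open>m - 1\<close>. Since \<open>w \<cdot> x\<close> is the parity of \<open>card (supp w \<inter> supp x)\<close>, the Walsh transform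
  of the characteristic function at \<open>w\<close> is the sum of \<open>(-1) ^ card (A \<inter> B)\<close> over the blocks \<open>A\<close>
  (\<open>walsh_char_fun\<close>). It therefore depends only on the intersection numbers
  \<open>y i = card {A \<in> \<B>. card (A \<inter> B) = i}\<close> and equals their alternating sum. It remains to see that
  these numbers are the unique solution of the system.

  The binomial equations are a double count of the pairs of a block and an \<open>r\<close>-subset of \<open>B\<close> lying
  in it (\<open>design_binomial_moment\<close>). The value of \<open>y m\<close> is clear, because \<open>B\<close> is the only
  \<open>m\<close>-set that meets \<open>B\<close> in \<open>m\<close> points. The condition on \<open>y 0\<close>, which counts the blocks
  disjoint from \<open>B\<close>, is the one real constraint: only the complement of \<open>B\<close> can be such a block, so
  the condition says that complements of blocks are blocks. It follows from the binomial equations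
  by inclusion-exclusion, which yields
  \<open>y 0 - (-1) ^ m * y m = (1 - (-1) ^ m) / (m + 1)\<close> (\<open>disjoint_blocks_equation\<close>). For even \<open>m\<close>
  this is the claim. For odd \<open>m\<close> the sum of the two nonnegative integers \<open>y 0\<close> and \<open>y m\<close> would be
  \<open>2 / (m + 1)\<close>, which lies strictly between 0 and 1, so no such design exists.

  Uniqueness holds because the system is triangular: \<open>y m\<close> is prescribed, and the equation
  with index \<open>r\<close> expresses \<open>y r\<close> by the later unknowns (\<open>binomial_system_unique\<close>).
\<close>

section \<open>Counting blocks through a set of points\<close>

lemma card_subsets_between:
  assumes "finite A" "R \<subseteq> A" "card R \<le> t"
  shows "card {T. R \<subseteq> T \<and> T \<subseteq> A \<and> card T = t} = (card A - card R) choose (t - card R)"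
proof -
  have fR: "finite R" using assms finite_subset by blast
  have "bij_betw (\<lambda>S. S \<union> R) {S. S \<subseteq> A - R \<and> card S = t - card R}
          {T. R \<subseteq> T \<and> T \<subseteq> A \<and> card T = t}"
  proof (rule bij_betw_byWitness[where f' = "\<lambda>T. T - R"])
    show "(\<lambda>S. S \<union> R) ` {S. S \<subseteq> A - R \<and> card S = t - card R}
        \<subseteq> {T. R \<subseteq> T \<and> T \<subseteq> A \<and> card T = t}"
    proof safe
      fix S assume S: "S \<subseteq> A - R" "card S = t - card R"
      then have "card (S \<union> R) = card S + card R"
        using fR assms finite_subset[of S A] by (intro card_Un_disjoint) auto
      then show "card (S \<union> R) = t" using S assms by simp
    qed (use assms in auto)
    show "(\<lambda>T. T - R) ` {T. R \<subseteq> T \<and> T \<subseteq> A \<and> card T = t}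
        \<subseteq> {S. S \<subseteq> A - R \<and> card S = t - card R}"
      using fR by (auto simp: card_Diff_subset)
  qed auto
  then have "card {T. R \<subseteq> T \<and> T \<subseteq> A \<and> card T = t}
      = card {S. S \<subseteq> A - R \<and> card S = t - card R}"
    by (simp add: bij_betw_same_card)
  also have "\<dots> = card (A - R) choose (t - card R)"
    using assms by (simp add: n_subsets)
  finally show ?thesis
    using assms fR by (simp add: card_Diff_subset)
qed

lemma t_design_finite:
  assumes "t_design t n k l \<B>"
  shows "finite \<B>"
proof -
  have "\<B> \<subseteq> Pow {1..n}" using assms by (auto simp: t_design_def)
  then show ?thesis using finite_subset by blast
qed

text \<open>
  Double counting: the numerator and the denominator of \<open>\<lambda>\<^sub>s\<close> come from the two ways to count
  the pairs of a \<open>t\<close>-set \<open>T\<close> and a block \<open>A\<close> with \<open>R \<subseteq> T \<subseteq> A\<close>.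
\<close>

lemma t_design_card_blocks_containing:
  assumes D: "t_design t n k l \<B>" and R: "R \<subseteq> {1..n}" and le: "card R \<le> t"
  shows "real (card {A \<in> \<B>. R \<subseteq> A}) = design_lambda t n k l (card R)"
proof -
  define TT where "TT = {T. R \<subseteq> T \<and> T \<subseteq> {1..n} \<and> card T = t}"
  define BB where "BB = {A \<in> \<B>. R \<subseteq> A}"
  have tk: "t \<le> k" and blk: "\<And>A. A \<in> \<B> \<Longrightarrow> A \<subseteq> {1..n} \<and> card A = k"
    and cov: "\<And>T. T \<subseteq> {1..n} \<Longrightarrow> card T = t \<Longrightarrow> card {A \<in> \<B>. T \<subseteq> A} = l"
    using D by (auto simp: t_design_def)
  have "finite TT" unfolding TT_def by (rule finite_subset[of _ "Pow {1..n}"]) auto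
  moreover have "finite BB" unfolding BB_def using t_design_finite[OF D] by simp
  moreover have "\<forall>A\<in>BB. card {T \<in> TT. T \<subseteq> A} = (k - card R) choose (t - card R)"
  proof
    fix A assume A: "A \<in> BB"
    then have sub: "A \<subseteq> {1..n}" "card A = k" "R \<subseteq> A" using blk by (auto simp: BB_def)
    then have "{T \<in> TT. T \<subseteq> A} = {T. R \<subseteq> T \<and> T \<subseteq> A \<and> card T = t}"
      by (auto simp: TT_def)
    then show "card {T \<in> TT. T \<subseteq> A} = (k - card R) choose (t - card R)"
      using card_subsets_between[of A R t] sub le finite_subset[of A "{1..n}"] by simp
  qed
  ultimately have "(\<Sum>T\<in>TT. card {A \<in> BB. T \<subseteq> A})
      = (\<Sum>A\<in>BB. (k - card R) choose (t - card R))"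
    by (rule sum_multicount_gen)
  moreover have "(\<Sum>T\<in>TT. card {A \<in> BB. T \<subseteq> A}) = (\<Sum>T\<in>TT. l)"
  proof (rule sum.cong)
    fix T assume T: "T \<in> TT"
    then have "{A \<in> BB. T \<subseteq> A} = {A \<in> \<B>. T \<subseteq> A}" by (auto simp: TT_def BB_def)
    then show "card {A \<in> BB. T \<subseteq> A} = l" using cov T by (auto simp: TT_def)
  qed simp
  moreover have "card TT = (n - card R) choose (t - card R)"
    using card_subsets_between[of "{1..n}" R t] R le by (simp add: TT_def)
  ultimately have "((n - card R) choose (t - card R)) * l
      = card BB * ((k - card R) choose (t - card R))"
    by simp
  then have "real l * real ((n - card R) choose (t - card R))
      = real (card BB) * real ((k - card R) choose (t - card R))"
    by (metis of_nat_mult mult.commute)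
  moreover have "(k - card R) choose (t - card R) > 0"
    using tk by (simp add: zero_less_binomial_iff)
  ultimately show ?thesis
    by (simp add: design_lambda_def BB_def field_simps)
qed

text \<open>
  The summand on the left counts the \<open>r\<close>-subsets of \<open>S\<close> that lie in \<open>A\<close>.
\<close>

lemma sum_binomial_card_Int:
  assumes "finite \<B>" "finite S"
  shows "(\<Sum>A\<in>\<B>. card (A \<inter> S) choose r)
       = (\<Sum>R | R \<subseteq> S \<and> card R = r. card {A \<in> \<B>. R \<subseteq> A})"
proof -
  have "(\<Sum>R | R \<subseteq> S \<and> card R = r. card {A \<in> \<B>. R \<subseteq> A})
      = (\<Sum>A\<in>\<B>. card (A \<inter> S) choose r)"
  proof (rule sum_multicount_gen)
    show "\<forall>A\<in>\<B>. card {R \<in> {R. R \<subseteq> S \<and> card R = r}. R \<subseteq> A} = card (A \<inter> S) choose r"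
    proof
      fix A
      have "{R \<in> {R. R \<subseteq> S \<and> card R = r}. R \<subseteq> A} = {R. R \<subseteq> A \<inter> S \<and> card R = r}" by auto
      then show "card {R \<in> {R. R \<subseteq> S \<and> card R = r}. R \<subseteq> A} = card (A \<inter> S) choose r"
        using assms n_subsets[of "A \<inter> S" r] by (simp only: finite_Int simp_thms)
    qed
  qed (use assms in auto)
  then show ?thesis by simp
qed

lemma design_binomial_moment:
  assumes D: "t_design t n k l \<B>" and S: "S \<subseteq> {1..n}" and r: "r \<le> t"
  shows "(\<Sum>A\<in>\<B>. real (card (A \<inter> S) choose r))
       = real (card S choose r) * design_lambda t n k l r"
proof -
  have fS: "finite S" using S finite_subset by blast
  have "(\<Sum>A\<in>\<B>. real (card (A \<inter> S) choose r))
      = (\<Sum>R | R \<subseteq> S \<and> card R = r. real (card {A \<in> \<B>. R \<subseteq> A}))"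
    using sum_binomial_card_Int[OF t_design_finite[OF D] fS, of r]
    by (simp flip: of_nat_sum)
  also have "\<dots> = (\<Sum>R | R \<subseteq> S \<and> card R = r. design_lambda t n k l r)"
    using t_design_card_blocks_containing[OF D] S r by (intro sum.cong) auto
  also have "\<dots> = real (card S choose r) * design_lambda t n k l r"
    using fS by (simp add: n_subsets)
  finally show ?thesis .
qed

section \<open>Intersection numbers\<close>

definition intersection_number :: "'a set set \<Rightarrow> 'a set \<Rightarrow> nat \<Rightarrow> nat" where
  "intersection_number \<B> S i = card {A \<in> \<B>. card (A \<inter> S) = i}"

lemma sum_by_intersection_number:
  fixes g :: "nat \<Rightarrow> real"
  assumes "finite \<B>" "finite S" "card S \<le> m"
  shows "(\<Sum>A\<in>\<B>. g (card (A \<inter> S))) = (\<Sum>i=0..m. g i * real (intersection_number \<B> S i))"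
proof -
  have le: "card (A \<inter> S) \<le> m" for A
    using assms card_mono[of S "A \<inter> S"] by simp
  have "(\<Sum>i=0..m. g i * real (intersection_number \<B> S i))
      = (\<Sum>i=0..m. \<Sum>A | A \<in> \<B> \<and> card (A \<inter> S) = i. g (card (A \<inter> S)))"
    by (simp add: intersection_number_def mult.commute)
  also have "\<dots> = (\<Sum>A\<in>\<B>. g (card (A \<inter> S)))"
    using assms le by (intro sum.group) auto
  finally show ?thesis by simp
qed

lemma intersection_number_full:
  assumes "\<And>A. A \<in> \<B> \<Longrightarrow> finite A \<and> card A = m" and "finite B" "card B = m"
  shows "intersection_number \<B> B m = (if B \<in> \<B> then 1 else 0)"
proof -
  have "A = B" if "A \<in> \<B>" "card (A \<inter> B) = m" for A
    using that assms card_subset_eq[of A "A \<inter> B"] card_subset_eq[of B "A \<inter> B"] by auto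
  moreover have "card (B \<inter> B) = m" using assms(3) by simp
  ultimately have "{A \<in> \<B>. card (A \<inter> B) = m} = (if B \<in> \<B> then {B} else {})"
    by (cases "B \<in> \<B>") (simp_all only: if_True if_False, blast+)
  then show ?thesis by (simp add: intersection_number_def)
qed

section \<open>Blocks disjoint from a half-size set\<close>

text \<open>
  The left-hand side is the \<open>a\<close>-fold forward difference at \<open>N\<close> of the function
  \<open>x \<mapsto> x choose (k + a)\<close>; by Pascal's rule each difference lowers the lower index by one.
\<close>

lemma alternating_binomial_difference:
  "(\<Sum>r\<le>a. (-1) ^ r * real (a choose r) * real ((N + a - r) choose (k + a))) = real (N choose k)"
proof (induction a arbitrary: k)
  case 0
  then show ?case by simp
next
  case (Suc a)
  define f where "f r = real ((N + Suc a - r) choose (k + Suc a))" for r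
  have "(\<Sum>r\<le>Suc a. (-1) ^ r * real (Suc a choose r) * f r)
      = f 0 + (\<Sum>r\<le>a. (-1) ^ Suc r * real (a choose r) * f (Suc r))
            + (\<Sum>r\<le>a. (-1) ^ Suc r * real (a choose Suc r) * f (Suc r))"
    by (subst sum.atMost_Suc_shift) (simp add: sum.distrib[symmetric] algebra_simps del: sum.atMost_Suc)
  also have "f 0 + (\<Sum>r\<le>a. (-1) ^ Suc r * real (a choose r) * f (Suc r))
            + (\<Sum>r\<le>a. (-1) ^ Suc r * real (a choose Suc r) * f (Suc r))
      = (\<Sum>r\<le>a. (-1) ^ Suc r * real (a choose r) * f (Suc r))
        + (\<Sum>r\<le>Suc a. (-1) ^ r * real (a choose r) * f r)"
    using sum.atMost_Suc_shift[of "\<lambda>r. (-1) ^ r * real (a choose r) * f r" a]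
    by (simp del: sum.atMost_Suc)
  also have "(\<Sum>r\<le>Suc a. (-1) ^ r * real (a choose r) * f r)
      = (\<Sum>r\<le>a. (-1) ^ r * real (a choose r) * f r)"
    by (simp add: binomial_eq_0)
  also have "(\<Sum>r\<le>a. (-1) ^ Suc r * real (a choose r) * f (Suc r))
        + (\<Sum>r\<le>a. (-1) ^ r * real (a choose r) * f r)
      = (\<Sum>r\<le>a. (-1) ^ r * real (a choose r) * real ((N + a - r) choose (k + a)))"
    unfolding sum.distrib[symmetric]
  proof (rule sum.cong)
    fix r assume "r \<in> {..a}"
    then have "N + Suc a - r = Suc (N + a - r)" by auto
    then have "f r = real ((N + a - r) choose (k + a)) + f (Suc r)"
      by (simp add: f_def)
    then show "(-1) ^ Suc r * real (a choose r) * f (Suc r) + (-1) ^ r * real (a choose r) * f r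
        = (-1) ^ r * real (a choose r) * real ((N + a - r) choose (k + a))"
      by (simp add: algebra_simps)
  qed simp
  also have "\<dots> = real (N choose k)" by (rule Suc.IH)
  finally show ?case by (simp add: f_def)
qed

text \<open>
  The closed form shows that \<open>\<lambda>\<^sub>r\<close> is the number of all \<open>m\<close>-subsets containing a given \<open>r\<close>-set,
  divided by \<open>m + 1\<close>. Unlike the defining quotient it makes sense for \<open>r = m\<close> too,
  which lets the alternating sum below be completed to a full difference.
\<close>

lemma design_lambda_half:
  assumes "r < m"
  shows "design_lambda (m - 1) (2 * m) m 1 r = real ((2 * m - r) choose m) / real (m + 1)"
proof -
  obtain j where m: "m = Suc (r + j)" using assms less_iff_Suc_add by blast
  have e: "2 * m - r = m + Suc j" "m - 1 - r = j" "m - r = Suc j" using m by auto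
  have "(m + Suc j) choose j = (m + Suc j) choose Suc m"
    by (subst binomial_symmetric) auto
  moreover have "Suc m * ((m + Suc j) choose Suc m) = Suc j * ((m + Suc j) choose m)"
    by (metis add_diff_cancel_left' binomial_absorb_comp binomial_absorption)
  ultimately have "real (m + 1) * real ((m + Suc j) choose j)
      = real (Suc j) * real ((m + Suc j) choose m)"
    by (metis Suc_eq_plus1 of_nat_mult)
  moreover have "Suc j choose j = Suc j"
    by (metis Suc_n_not_le_n binomial_Suc_n)
  ultimately show ?thesis
    unfolding design_lambda_def e by (simp add: field_simps)
qed

text \<open>
  Inclusion-exclusion over the subsets of \<open>B\<close> counts the blocks disjoint from \<open>B\<close>. The design
  determines the contribution of every proper subset, and that of \<open>B\<close> itself is \<open>(-1) ^ m\<close> times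
  the number of blocks containing \<open>B\<close>.
\<close>

lemma disjoint_blocks_equation:
  assumes D: "t_design (m - 1) (2 * m) m 1 \<B>" and B: "B \<subseteq> {1..2 * m}" "card B = m"
  shows "real (intersection_number \<B> B 0) - (-1) ^ m * real (intersection_number \<B> B m)
       = (1 - (-1) ^ m) / real (m + 1)"
proof -
  have fB: "finite B" using B finite_subset by blast
  have fD: "finite \<B>" by (rule t_design_finite[OF D])
  have m: "m > 0" using D by (cases m) (auto simp: t_design_def)
  have le: "card (A \<inter> B) \<le> m" for A using fB B card_mono[of B "A \<inter> B"] by auto
  \<comment> \<open>\<open>M r\<close> counts the pairs of a block and an \<open>r\<close>-subset of \<open>B\<close> contained in it.\<close>
  define M where "M r = (\<Sum>A\<in>\<B>. real (card (A \<inter> B) choose r))" for r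
  \<comment> \<open>A block meeting \<open>B\<close> in \<open>i\<close> points contributes this number to the alternating sum of \<open>M\<close>.\<close>
  have ie: "(\<Sum>r\<le>m. (-1) ^ r * real (i choose r)) = (if i = 0 then 1 else 0)" if "i \<le> m" for i
  proof -
    have "(\<Sum>r\<le>m. (-1) ^ r * real (i choose r)) = (\<Sum>r\<le>i. (-1) ^ r * real (i choose r))"
      using that by (intro sum.mono_neutral_right) (auto simp: binomial_eq_0)
    also have "\<dots> = (if i = 0 then 1 else 0)"
      using choose_alternating_sum[of i, where ?'a = real] by auto
    finally show ?thesis .
  qed
  have "(\<Sum>r\<le>m. (-1) ^ r * M r)
      = (\<Sum>A\<in>\<B>. \<Sum>r\<le>m. (-1) ^ r * real (card (A \<inter> B) choose r))"
    unfolding M_def sum_distrib_left by (rule sum.swap)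
  also have "\<dots> = (\<Sum>A\<in>\<B>. if card (A \<inter> B) = 0 then 1 else 0)"
    by (intro sum.cong) (simp_all add: ie le)
  also have "\<dots> = real (intersection_number \<B> B 0)"
    using fD by (simp add: intersection_number_def sum.If_cases Int_def del: card_eq_0_iff card_0_eq)
  finally have y0: "(\<Sum>r\<le>m. (-1) ^ r * M r) = real (intersection_number \<B> B 0)" .
  have "M m = (\<Sum>A\<in>\<B>. if card (A \<inter> B) = m then 1 else 0)"
    unfolding M_def
  proof (rule sum.cong)
    fix A
    show "real (card (A \<inter> B) choose m) = (if card (A \<inter> B) = m then 1 else 0)"
      using le[of A] by (auto simp: binomial_eq_0)
  qed simp
  also have "\<dots> = real (intersection_number \<B> B m)"
    using fD by (simp add: intersection_number_def sum.If_cases Int_def)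
  finally have ym: "M m = real (intersection_number \<B> B m)" .
  have Mr: "M r = real (m choose r) * (real ((2 * m - r) choose m) / real (m + 1))" if "r < m" for r
    using design_binomial_moment[OF D B(1), of r] design_lambda_half[of r m] that B
    by (simp add: M_def)
  have "(\<Sum>r\<le>m. (-1) ^ r * M r) - (-1) ^ m * M m = (\<Sum>r<m. (-1) ^ r * M r)"
    by (simp add: lessThan_Suc_atMost[symmetric])
  also have "\<dots> = (\<Sum>r<m. (-1) ^ r * real (m choose r) * real ((2 * m - r) choose m)) / real (m + 1)"
    by (simp add: Mr sum_divide_distrib algebra_simps)
  also have "(\<Sum>r<m. (-1) ^ r * real (m choose r) * real ((2 * m - r) choose m))
      = (\<Sum>r\<le>m. (-1) ^ r * real (m choose r) * real ((2 * m - r) choose m)) - (-1) ^ m"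
    by (simp add: lessThan_Suc_atMost[symmetric])
  also have "(\<Sum>r\<le>m. (-1) ^ r * real (m choose r) * real ((2 * m - r) choose m)) = 1"
    using alternating_binomial_difference[where a = m and N = m and k = 0] by (simp add: mult_2)
  finally show ?thesis using y0 ym by simp
qed

text \<open>
  For even \<open>m\<close> this is \<open>disjoint_blocks_equation\<close> itself. For odd \<open>m\<close> that equation gives
  \<open>(y 0 + y m) * (m + 1) = 2\<close>, which has no solution in natural numbers because \<open>m\<close> is at least 2
  when the strength \<open>m - 1\<close> is positive.
\<close>

lemma intersection_number_empty_eq_full:
  assumes D: "t_design (m - 1) (2 * m) m 1 \<B>" and B: "B \<subseteq> {1..2 * m}" "card B = m"
  shows "intersection_number \<B> B 0 = intersection_number \<B> B m"
proof (cases "even m")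
  case True
  then show ?thesis using disjoint_blocks_equation[OF assms] by simp
next
  case False
  have "m \<ge> 2" using D by (auto simp: t_design_def)
  have "real (intersection_number \<B> B 0 + intersection_number \<B> B m) * real (m + 1) = 2"
    using disjoint_blocks_equation[OF assms] False by (simp add: field_simps)
  then have "real ((intersection_number \<B> B 0 + intersection_number \<B> B m) * (m + 1)) = real 2"
    by (simp only: of_nat_mult of_nat_numeral)
  then have "(intersection_number \<B> B 0 + intersection_number \<B> B m) * (m + 1) = 2"
    by (simp only: of_nat_eq_iff)
  then have "(m + 1) dvd 2" by (metis dvd_triv_right)
  then have "m + 1 \<le> 2" by (rule dvd_imp_le) simp
  then show ?thesis using \<open>m \<ge> 2\<close> by simp
qed

section \<open>The triangular system\<close>

text \<open>
  In the equation with index \<open>r\<close> the unknown \<open>y r\<close> has coefficient 1 and no earlier unknown occurs,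
  so the values are recovered from \<open>y m\<close> downwards.
\<close>

lemma binomial_system_unique:
  fixes y z :: "nat \<Rightarrow> real"
  assumes "\<And>r. r < m \<Longrightarrow> (\<Sum>i=r..m. real (i choose r) * y i) = (\<Sum>i=r..m. real (i choose r) * z i)"
    and "y m = z m" and "i \<le> m"
  shows "y i = z i"
  using \<open>i \<le> m\<close>
proof (induction "m - i" arbitrary: i rule: less_induct)
  case less
  show ?case
  proof (cases "i = m")
    case False
    with less.prems have lt: "i < m" by simp
    have split: "(\<Sum>j=i..m. real (j choose i) * u j) = u i + (\<Sum>j=Suc i..m. real (j choose i) * u j)"
      for u :: "nat \<Rightarrow> real"
      using lt by (simp add: sum.atLeast_Suc_atMost)
    have "(\<Sum>j=Suc i..m. real (j choose i) * y j) = (\<Sum>j=Suc i..m. real (j choose i) * z j)"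
      using less.hyps lt by (intro sum.cong) auto
    then show ?thesis using assms(1)[OF lt] by (simp add: split)
  qed (use assms in simp)
qed

lemma y_system_unique:
  assumes "y_system (2 * m) \<B> B y" "y_system (2 * m) \<B> B z" "m > 0" "i \<le> m"
  shows "y i = z i"
proof (rule binomial_system_unique[of m])
  fix r assume "r < m"
  then have "r \<in> {0..(2 * m - 2) div 2}" by auto
  then show "(\<Sum>i=r..m. real (i choose r) * y i) = (\<Sum>i=r..m. real (i choose r) * z i)"
    using assms(1,2) unfolding y_system_def by simp
qed (use assms in \<open>auto simp: y_system_def\<close>)

text \<open>
  The system reads only the values up to \<open>n div 2\<close>, so a solution stays one when it is made extensional.
\<close>

lemma y_system_cong:
  assumes "\<And>i. i \<le> n div 2 \<Longrightarrow> y i = z i"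
  shows "y_system n \<B> B y \<longleftrightarrow> y_system n \<B> B z"
proof -
  have "(\<Sum>i=r..n div 2. real (i choose r) * y i) = (\<Sum>i=r..n div 2. real (i choose r) * z i)" for r
    using assms by (intro sum.cong) auto
  then show ?thesis using assms by (simp add: y_system_def)
qed

lemma y_system_intersection_number:
  assumes D: "t_design (m - 1) (2 * m) m 1 \<B>" and B: "B \<subseteq> {1..2 * m}" "card B = m"
  shows "y_system (2 * m) \<B> B (\<lambda>i. real (intersection_number \<B> B i))"
proof -
  have fB: "finite B" using B finite_subset by blast
  have e: "(2 * m - 2) div 2 = m - 1" "2 * m div 2 = m" by auto
  have full: "intersection_number \<B> B m = (if B \<in> \<B> then 1 else 0)"
  proof (rule intersection_number_full)
    fix A assume "A \<in> \<B>"
    then have "A \<subseteq> {1..2 * m}" "card A = m" using D by (auto simp: t_design_def)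
    then show "finite A \<and> card A = m" using finite_subset by blast
  qed (use fB B in auto)
  have "(\<Sum>i=r..m. real (i choose r) * real (intersection_number \<B> B i))
      = real (m choose r) * design_lambda (m - 1) (2 * m) m 1 r" if "r \<le> m - 1" for r
  proof -
    have "(\<Sum>i=r..m. real (i choose r) * real (intersection_number \<B> B i))
        = (\<Sum>i=0..m. real (i choose r) * real (intersection_number \<B> B i))"
      by (intro sum.mono_neutral_left) (auto simp: binomial_eq_0)
    also have "\<dots> = (\<Sum>A\<in>\<B>. real (card (A \<inter> B) choose r))"
      using sum_by_intersection_number[OF t_design_finite[OF D] fB, of m "\<lambda>i. real (i choose r)"] B
      by simp
    also have "\<dots> = real (m choose r) * design_lambda (m - 1) (2 * m) m 1 r"
      using design_binomial_moment[OF D B(1) that] B by simp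
    finally show ?thesis .
  qed
  then show ?thesis
    unfolding y_system_def e using full intersection_number_empty_eq_full[OF assms] by simp
qed

section \<open>The Walsh transform of a family of sets\<close>

lemma odd_mult_bit_iff: "odd (a * b) \<longleftrightarrow> a = 1 \<and> b = 1" for a b :: bit
proof -
  have "odd c \<longleftrightarrow> c = 1" for c :: bit
    by (cases c) simp_all
  then show ?thesis
    by (simp only: even_mult_iff de_Morgan_disj)
qed

text \<open>
  The sum \<open>gf2_dot n w x\<close> in GF(2) has one odd summand for each common point of the two supports.
\<close>

lemma minus_one_power_gf2_dot:
  "(-1 :: real) ^ of_bit (gf2_dot n w x) = (-1) ^ card (supp n x \<inter> supp n w)"
proof -
  have odd_terms: "{i \<in> {1..n}. odd (w i * x i)} = supp n x \<inter> supp n w"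
    unfolding supp_def odd_mult_bit_iff by fast
  have "even (gf2_dot n w x) \<longleftrightarrow> even (card (supp n x \<inter> supp n w))"
    unfolding gf2_dot_def even_sum_iff[OF finite_atLeastAtMost] odd_terms by (rule refl)
  moreover have "(-1 :: real) ^ of_bool (\<not> P) = (if P then 1 else -1)" for P
    by simp
  ultimately show ?thesis
    by (simp only: minus_one_power_iff)
qed

lemma bij_betw_supp: "bij_betw (supp n) (gf2_vec n) (Pow {1..n})"
proof (rule bij_betw_byWitness[where f' = "\<lambda>A. \<lambda>i\<in>{1..n}. if i \<in> A then 1 else 0"])
  show "\<forall>x\<in>gf2_vec n. (\<lambda>i\<in>{1..n}. if i \<in> supp n x then 1 else 0) = x"
  proof
    fix x assume x: "x \<in> gf2_vec n"
    show "(\<lambda>i\<in>{1..n}. if i \<in> supp n x then 1 else 0) = x"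
    proof
      fix i
      show "(\<lambda>i\<in>{1..n}. if i \<in> supp n x then 1 else 0) i = x i"
        using x by (cases "x i") (auto simp: gf2_vec_def supp_def PiE_def extensional_def)
    qed
  qed
  show "\<forall>A\<in>Pow {1..n}. supp n (\<lambda>i\<in>{1..n}. if i \<in> A then 1 else 0) = A"
  proof
    fix A assume A: "A \<in> Pow {1..n}"
    have "(\<lambda>i\<in>{1..n}. if i \<in> A then 1 else 0) i = (1 :: bit) \<longleftrightarrow> i \<in> A" if "i \<in> {1..n}" for i
      using that by simp
    then show "supp n (\<lambda>i\<in>{1..n}. if i \<in> A then 1 else 0) = A"
      using A unfolding supp_def by blast
  qed
  show "supp n ` gf2_vec n \<subseteq> Pow {1..n}"
    unfolding supp_def by blast
  show "(\<lambda>A. \<lambda>i\<in>{1..n}. if i \<in> A then 1 else 0) ` Pow {1..n} \<subseteq> gf2_vec n"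
    unfolding gf2_vec_def by (intro image_subsetI restrict_PiE_iff[THEN iffD2] ballI UNIV_I)
qed

lemma walsh_char_fun:
  assumes "\<B> \<subseteq> Pow {1..n}"
  shows "walsh n (char_fun n \<B>) w = (\<Sum>A\<in>\<B>. (-1) ^ card (A \<inter> supp n w))"
proof -
  have "walsh n (char_fun n \<B>) w
      = (\<Sum>x\<in>gf2_vec n. (\<lambda>A. (if A \<in> \<B> then 1 else 0) * (-1) ^ card (A \<inter> supp n w)) (supp n x))"
    by (simp only: walsh_def char_fun_def minus_one_power_gf2_dot)
  also have "\<dots> = (\<Sum>A\<in>Pow {1..n}. (if A \<in> \<B> then 1 else 0) * (-1) ^ card (A \<inter> supp n w))"
    by (rule sum.reindex_bij_betw[OF bij_betw_supp])
  also have "\<dots> = (\<Sum>A\<in>\<B>. (-1) ^ card (A \<inter> supp n w))"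
    using assms by (intro sum.mono_neutral_cong_right) auto
  finally show ?thesis .
qed

section \<open>The Walsh transform of the design\<close>

theorem theorem32:
  fixes n :: nat and \<B> :: "nat set set" and w :: "nat \<Rightarrow> bit" and B :: "nat set"
  assumes "n \<ge> 4" and "even n"
    and "t_design ((n - 2) div 2) n (n div 2) 1 \<B>"
    and "w \<in> gf2_vec n" and "wt n w = n div 2" and "B = supp n w"
  shows "(\<exists>!y. y \<in> {0..n div 2} \<rightarrow>\<^sub>E (UNIV :: real set) \<and> y_system n \<B> B y) \<and>
         (\<forall>y. y_system n \<B> B y \<longrightarrow>
            walsh n (char_fun n \<B>) w = (\<Sum>i=0..n div 2. (- 1) ^ i * y i))"
proof -
  obtain m where n: "n = 2 * m" using \<open>even n\<close> by blast
  have half: "n div 2 = m" "(n - 2) div 2 = m - 1" and m: "m > 0" using n \<open>n \<ge> 4\<close> by auto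
  have D: "t_design (m - 1) (2 * m) m 1 \<B>" using assms(3) unfolding half unfolding n .
  have B: "B \<subseteq> {1..2 * m}" "card B = m"
    using assms(5,6) half n by (auto simp: supp_def wt_def)
  have fB: "finite B" using B finite_subset by blast
  define y where "y = (\<lambda>i. real (intersection_number \<B> B i))"
  have sol: "y_system n \<B> B y"
    unfolding y_def n by (rule y_system_intersection_number[OF D B])
  have uniq: "z i = y i" if "y_system n \<B> B z" "i \<le> m" for z i
    using y_system_unique[of m \<B> B z y i] that sol m n by simp
  have "\<exists>!y. y \<in> {0..m} \<rightarrow>\<^sub>E (UNIV :: real set) \<and> y_system n \<B> B y"
  proof (rule ex1I[of _ "restrict y {0..m}"])
    show "restrict y {0..m} \<in> {0..m} \<rightarrow>\<^sub>E UNIV \<and> y_system n \<B> B (restrict y {0..m})"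
      using sol y_system_cong[of n "restrict y {0..m}" y] half by auto
  next
    fix z assume "z \<in> {0..m} \<rightarrow>\<^sub>E (UNIV :: real set) \<and> y_system n \<B> B z"
    then show "z = restrict y {0..m}"
      using uniq by (intro extensionalityI[of _ "{0..m}"]) (auto simp: PiE_def)
  qed
  moreover have "walsh n (char_fun n \<B>) w = (\<Sum>i=0..m. (-1) ^ i * z i)"
    if z: "y_system n \<B> B z" for z
  proof -
    have "\<B> \<subseteq> Pow {1..n}" using assms(3) by (auto simp: t_design_def)
    then have "walsh n (char_fun n \<B>) w = (\<Sum>A\<in>\<B>. (-1) ^ card (A \<inter> B))"
      using walsh_char_fun assms(6) by simp
    also have "\<dots> = (\<Sum>i=0..m. (-1) ^ i * y i)"
      unfolding y_def using B by (intro sum_by_intersection_number t_design_finite[OF D] fB) simp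
    also have "\<dots> = (\<Sum>i=0..m. (-1) ^ i * z i)"
      using uniq[OF z] by (intro sum.cong) auto
    finally show ?thesis .
  qed
  ultimately show ?thesis unfolding half by blast
qed

end
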